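(* There is no (deterministic) algorithm, regardless of running time, that is strategy-proof for residents and returns an optimal solution (a stable matching of maximum score) for every instance of HRT-MSLQ. The statement holds even for the uniform model and for the marriage model: there is no such algorithm defined on the family of all instances in which all hospitals have the same lower quota and the same upper quota, and there is no such algorithm defined on the family of all instances in which every hospital has upper quota $1$.
   Context: An instance $I$ of HRT-MSLQ consists of a set $R=\{r_1,\dots,r_n\}$ of residents ($n\ge 1$) and a set $H=\{h_1,\dots,h_m\}$ of hospitals. Each resident $r$ has a complete preference list over $H$ that may contain ties (a total preorder $\succeq_r$; $\succ_r$ is strict preference), and each hospital likewise has a complete preference list over $R$ that may contain ties. Each hospital $h$ has an integer lower quota $\ell(h)$ and upper quota $u(h)$ with $0\le \ell(h)\le u(h)\le n$, $u(h)\ge 1$. Standing assumption: $|R|<\sum_{h\in H}u(h)$. An assignment is a set $M\subseteq R\times H$; $M(r)=\{h:(r,h)\in M\}$, $M(h)=\{r:(r,h)\in M\}$. $M$ is a matching if $|M(r)|\le 1$ for all $r$ and $|M(h)|\le u(h)$ for all $h$; then $M(r)$ also denotes the unique hospital of a matched resident $r$. A pair $(r,h)$ blocks a matching $M$ if (i) $r$ is unmatched in $M$ or $h\succ_r M(r)$, and (ii) $|M(h)|<u(h)$ or $h$ strictly prefers $r$ to at least one resident in $M(h)$. $M$ is stable if no pair blocks it (under the standing assumption every resident is matched in every stable matching). The score of $h$ in $M$ is $s_M(h)=\min\{1,|M(h)|/\ell(h)\}$, with $s_M(h)=1$ if $\ell(h)=0$; the score of $M$ is $s(M)=\sum_{h\in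 H}s_M(h)$. An optimal solution of $I$ is a stable matching of $I$ maximizing $s(M)$. A deterministic algorithm $A$ is regarded as a map from instances to matchings. It is strategy-proof for residents if, for every instance $I$, every resident $r$ with preference $\succeq_r$ in $I$, and every instance $I'$ obtained from $I$ by replacing $\succeq_r$ by another complete list $\succeq_r'$ (possibly with ties), the outputs $M=A(I)$, $M'=A(I')$ satisfy $M(r)\succeq_r M'(r)$. *)

theory Defs
  imports Complex_Main "HOL-Library.FuncSet"
begin

text \<open>
  The resident \<open>r\<^sub>i\<close> is represented by the number \<open>i\<close>, and likewise the hospital \<open>h\<^sub>j\<close> by \<open>j\<close>.
  In a preference relation, \<open>(x, y) \<in> P\<close> means that \<open>x\<close> is at least as good as \<open>y\<close>.
\<close>

record hrt =
  num_residents :: nat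
  num_hospitals :: nat
  resident_pref :: "nat \<Rightarrow> nat rel"
  hospital_pref :: "nat \<Rightarrow> nat rel"
  lower :: "nat \<Rightarrow> nat"
  upper :: "nat \<Rightarrow> nat"

definition residents :: "hrt \<Rightarrow> nat set" where
  "residents I = {1..num_residents I}"

definition hospitals :: "hrt \<Rightarrow> nat set" where
  "hospitals I = {1..num_hospitals I}"

definition complete_lists :: "'a set \<Rightarrow> 'a rel set" where
  "complete_lists S = {P. preorder_on S P \<and> total_on S P}"

definition strictly_prefers :: "'a rel \<Rightarrow> 'a \<Rightarrow> 'a \<Rightarrow> bool" where
  "strictly_prefers P x y \<longleftrightarrow> (x, y) \<in> P \<and> (y, x) \<notin> P"

text \<open>
  Extensional function spaces ensure that an instance is determined by its preference lists
  and quotas on the actual residents and hospitals. So a function on instances cannot depend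
  on values outside of them.
\<close>

definition HRT_MSLQ :: "hrt set" where
  "HRT_MSLQ = {I.
     num_residents I \<ge> 1 \<and>
     resident_pref I \<in> residents I \<rightarrow>\<^sub>E complete_lists (hospitals I) \<and>
     hospital_pref I \<in> hospitals I \<rightarrow>\<^sub>E complete_lists (residents I) \<and>
     lower I \<in> hospitals I \<rightarrow>\<^sub>E UNIV \<and>
     upper I \<in> hospitals I \<rightarrow>\<^sub>E UNIV \<and>
     (\<forall>h\<in>hospitals I. lower I h \<le> upper I h \<and> upper I h \<le> num_residents I \<and> upper I h \<ge> 1) \<and>
     card (residents I) < (\<Sum>h\<in>hospitals I. upper I h)}"

definition uniform_HRT_MSLQ :: "hrt set" where
  "uniform_HRT_MSLQ =
     {I \<in> HRT_MSLQ. \<exists>l u. \<forall>h\<in>hospitals I. lower I h = l \<and> upper I h = u}"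

definition marriage_HRT_MSLQ :: "hrt set" where
  "marriage_HRT_MSLQ = {I \<in> HRT_MSLQ. \<forall>h\<in>hospitals I. upper I h = 1}"

type_synonym assignment = "(nat \<times> nat) set"

definition hospitals_of :: "assignment \<Rightarrow> nat \<Rightarrow> nat set" where
  "hospitals_of M r = {h. (r, h) \<in> M}"

definition residents_of :: "assignment \<Rightarrow> nat \<Rightarrow> nat set" where
  "residents_of M h = {r. (r, h) \<in> M}"

definition matching :: "hrt \<Rightarrow> assignment \<Rightarrow> bool" where
  "matching I M \<longleftrightarrow>
     M \<subseteq> residents I \<times> hospitals I \<and>
     (\<forall>r\<in>residents I. card (hospitals_of M r) \<le> 1) \<and>
     (\<forall>h\<in>hospitals I. card (residents_of M h) \<le> upper I h)"

definition unmatched :: "assignment \<Rightarrow> nat \<Rightarrow> bool" where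
  "unmatched M r \<longleftrightarrow> hospitals_of M r = {}"

text \<open>Only meaningful if \<open>r\<close> is matched in the matching \<open>M\<close>.\<close>
definition hospital_of :: "assignment \<Rightarrow> nat \<Rightarrow> nat" where
  "hospital_of M r = the_elem (hospitals_of M r)"

definition blocks :: "hrt \<Rightarrow> assignment \<Rightarrow> nat \<Rightarrow> nat \<Rightarrow> bool" where
  "blocks I M r h \<longleftrightarrow>
     (unmatched M r \<or> strictly_prefers (resident_pref I r) h (hospital_of M r)) \<and>
     (card (residents_of M h) < upper I h \<or>
      (\<exists>r'\<in>residents_of M h. strictly_prefers (hospital_pref I h) r r'))"

definition stable_matching :: "hrt \<Rightarrow> assignment \<Rightarrow> bool" where
  "stable_matching I M \<longleftrightarrow>
     matching I M \<and> (\<forall>r\<in>residents I. \<forall>h\<in>hospitals I. \<not> blocks I M r h)"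

definition hospital_score :: "hrt \<Rightarrow> assignment \<Rightarrow> nat \<Rightarrow> real" where
  "hospital_score I M h =
     (if lower I h = 0 then 1 else min 1 (real (card (residents_of M h)) / real (lower I h)))"

definition score :: "hrt \<Rightarrow> assignment \<Rightarrow> real" where
  "score I M = (\<Sum>h\<in>hospitals I. hospital_score I M h)"

definition optimal_solution :: "hrt \<Rightarrow> assignment \<Rightarrow> bool" where
  "optimal_solution I M \<longleftrightarrow>
     stable_matching I M \<and> (\<forall>M'. stable_matching I M' \<longrightarrow> score I M' \<le> score I M)"

text \<open>
  Being unmatched is regarded as worse than being assigned to any hospital. This case never
  arises for stable matchings, because the total upper quota exceeds the number of residents.
\<close>
definition weakly_prefers_outcome :: "hrt \<Rightarrow> nat \<Rightarrow> assignment \<Rightarrow> assignment \<Rightarrow> bool" where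
  "weakly_prefers_outcome I r M M' \<longleftrightarrow>
     unmatched M' r \<or>
     (\<not> unmatched M r \<and> (hospital_of M r, hospital_of M' r) \<in> resident_pref I r)"

definition misreport :: "hrt \<Rightarrow> nat \<Rightarrow> nat rel \<Rightarrow> hrt" where
  "misreport I r P = I\<lparr>resident_pref := (resident_pref I)(r := P)\<rparr>"

text \<open>
  An algorithm defined on a family \<open>F\<close> of instances is represented by a function of which only
  the values on \<open>F\<close> matter. The families \<open>HRT_MSLQ\<close>, \<open>uniform_HRT_MSLQ\<close> and
  \<open>marriage_HRT_MSLQ\<close> are closed under \<open>misreport\<close>.
\<close>

definition strategy_proof_for_residents :: "hrt set \<Rightarrow> (hrt \<Rightarrow> assignment) \<Rightarrow> bool" where
  "strategy_proof_for_residents F A \<longleftrightarrow>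
     (\<forall>I\<in>F. \<forall>r\<in>residents I. \<forall>P\<in>complete_lists (hospitals I).
        misreport I r P \<in> F \<longrightarrow> weakly_prefers_outcome I r (A I) (A (misreport I r P)))"

definition returns_optimal_solutions :: "hrt set \<Rightarrow> (hrt \<Rightarrow> assignment) \<Rightarrow> bool" where
  "returns_optimal_solutions F A \<longleftrightarrow> (\<forall>I\<in>F. optimal_solution I (A I))"

lemma residents_misreport [simp]: "residents (misreport I r P) = residents I"
  by (simp add: residents_def misreport_def)

lemma hospitals_misreport [simp]: "hospitals (misreport I r P) = hospitals I"
  by (simp add: hospitals_def misreport_def)

lemma misreport_in_HRT_MSLQ:
  assumes "I \<in> HRT_MSLQ" "r \<in> residents I" "P \<in> complete_lists (hospitals I)"
  shows "misreport I r P \<in> HRT_MSLQ"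
proof -
  have "resident_pref (misreport I r P) \<in> residents I \<rightarrow>\<^sub>E complete_lists (hospitals I)"
    using assms by (auto simp: HRT_MSLQ_def misreport_def PiE_iff extensional_def)
  moreover have "num_residents (misreport I r P) = num_residents I"
    "hospital_pref (misreport I r P) = hospital_pref I"
    "lower (misreport I r P) = lower I" "upper (misreport I r P) = upper I"
    by (simp_all add: misreport_def)
  ultimately show ?thesis
    using assms(1) by (simp add: HRT_MSLQ_def)
qed

lemma misreport_in_uniform_HRT_MSLQ:
  assumes "I \<in> uniform_HRT_MSLQ" "r \<in> residents I" "P \<in> complete_lists (hospitals I)"
  shows "misreport I r P \<in> uniform_HRT_MSLQ"
proof -
  have "lower (misreport I r P) = lower I" "upper (misreport I r P) = upper I"
    by (simp_all add: misreport_def)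
  then show ?thesis
    using assms misreport_in_HRT_MSLQ by (simp add: uniform_HRT_MSLQ_def)
qed

lemma misreport_in_marriage_HRT_MSLQ:
  assumes "I \<in> marriage_HRT_MSLQ" "r \<in> residents I" "P \<in> complete_lists (hospitals I)"
  shows "misreport I r P \<in> marriage_HRT_MSLQ"
proof -
  have "upper (misreport I r P) = upper I"
    by (simp add: misreport_def)
  then show ?thesis
    using assms misreport_in_HRT_MSLQ by (simp add: marriage_HRT_MSLQ_def)
qed

end

theory Submission
  imports Defs
begin

text \<open>
  Residents 1 and 2 compete for the last place at hospital 1, which is indifferent between them;
  whoever loses gets their second choice, hospital 2. A loser who reports hospital 3 as their
  second choice makes their own rejection costly for the score: a resident at hospital 2
  raises the score, one at hospital 3 does not. So the only optimal solution after the misreport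
  gives the loser hospital 1. In the marriage model hospital 2 is the only one with
  a positive lower quota. In the uniform model with quotas \<open>\<ell> = 1\<close> and \<open>u = 2\<close> two further
  residents, whom all hospitals prefer, occupy one place each at hospitals 1 and 3.
\<close>

section \<open>Reduction to a single manipulable instance\<close>

text \<open>The liar and the false list may depend on \<open>M\<close>, since an algorithm may break
  ties among optimal solutions in any way. The liar must gain under every optimal \<open>M'\<close>,
  so the notion mentions no algorithm.\<close>

definition manipulable :: "hrt \<Rightarrow> bool" where
  "manipulable I \<longleftrightarrow>
     (\<forall>M. optimal_solution I M \<longrightarrow>
       (\<exists>r\<in>residents I. \<exists>P\<in>complete_lists (hospitals I). \<forall>M'.
         optimal_solution (misreport I r P) M' \<longrightarrow> \<not> weakly_prefers_outcome I r M M'))"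

text \<open>Of \<open>F\<close> it is asked only that it contain \<open>I\<close> and the misreports
  from \<open>I\<close>, so one argument serves all three families.\<close>

lemma manipulable_imp_no_strategy_proof:
  assumes "manipulable I" "I \<in> F"
    and closed: "\<And>r P. r \<in> residents I \<Longrightarrow> P \<in> complete_lists (hospitals I) \<Longrightarrow> misreport I r P \<in> F"
  shows "\<nexists>A. strategy_proof_for_residents F A \<and> returns_optimal_solutions F A"
proof
  assume "\<exists>A. strategy_proof_for_residents F A \<and> returns_optimal_solutions F A"
  then obtain A where sp: "strategy_proof_for_residents F A" and opt: "returns_optimal_solutions F A"
    by blast
  from opt assms(2) have "optimal_solution I (A I)"
    by (simp add: returns_optimal_solutions_def)
  with assms(1) obtain r P where r: "r \<in> residents I" "P \<in> complete_lists (hospitals I)"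
    and bad: "\<And>M'. optimal_solution (misreport I r P) M' \<Longrightarrow> \<not> weakly_prefers_outcome I r (A I) M'"
    unfolding manipulable_def by metis
  have "misreport I r P \<in> F"
    using r closed by blast
  then show False
    using sp opt bad r assms(2)
    unfolding strategy_proof_for_residents_def returns_optimal_solutions_def by blast
qed

section \<open>Stable matchings as functions from residents to hospitals\<close>

definition graph :: "nat set \<Rightarrow> (nat \<Rightarrow> nat) \<Rightarrow> assignment" where
  "graph R f = (\<lambda>r. (r, f r)) ` R"

lemma hospitals_of_graph: "hospitals_of (graph R f) r = (if r \<in> R then {f r} else {})"
  by (auto simp: hospitals_of_def graph_def)

lemma residents_of_graph: "residents_of (graph R f) h = {r\<in>R. f r = h}"
  by (auto simp: residents_of_def graph_def)

text \<open>A sum of indicators can be evaluated by rewriting once the set of residents is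
  explicit.\<close>

lemma card_residents_of_graph:
  "finite R \<Longrightarrow> card (residents_of (graph R f) h) = (\<Sum>r\<in>R. if f r = h then 1 else 0)"
  by (simp add: residents_of_graph sum.If_cases Collect_conj_eq)

lemma hospital_of_graph: "r \<in> R \<Longrightarrow> hospital_of (graph R f) r = f r"
  by (simp add: hospital_of_def hospitals_of_graph)

lemma unmatched_graph: "unmatched (graph R f) r \<longleftrightarrow> r \<notin> R"
  by (simp add: unmatched_def hospitals_of_graph)

lemma weakly_prefers_outcome_graph:
  assumes "r \<in> R"
  shows "weakly_prefers_outcome I r (graph R f) (graph R g) \<longleftrightarrow> (f r, g r) \<in> resident_pref I r"
  using assms by (simp add: weakly_prefers_outcome_def unmatched_graph hospital_of_graph)

text \<open>In a graph nobody is unmatched, so only the strict preference remains in the first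
  blocking condition. The result speaks of finitely many values of \<open>f\<close> and can be
  decided by cases.\<close>

lemma stable_matching_graph_iff:
  assumes "f \<in> residents I \<rightarrow> hospitals I"
  shows "stable_matching I (graph (residents I) f) \<longleftrightarrow>
    (\<forall>h\<in>hospitals I. (\<Sum>r\<in>residents I. if f r = h then 1 else 0) \<le> upper I h) \<and>
    (\<forall>r\<in>residents I. \<forall>h\<in>hospitals I. strictly_prefers (resident_pref I r) h (f r) \<longrightarrow>
       (\<Sum>r\<in>residents I. if f r = h then 1 else 0) \<ge> upper I h \<and>
       (\<forall>r'\<in>residents I. f r' = h \<longrightarrow> \<not> strictly_prefers (hospital_pref I h) r r'))"
proof -
  have fin: "finite (residents I)"
    by (simp add: residents_def)
  have "graph (residents I) f \<subseteq> residents I \<times> hospitals I"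
    using assms by (auto simp: graph_def)
  moreover have "blocks I (graph (residents I) f) r h \<longleftrightarrow>
      strictly_prefers (resident_pref I r) h (f r) \<and>
      ((\<Sum>r\<in>residents I. if f r = h then 1 else 0) < upper I h \<or>
       (\<exists>r'\<in>residents I. f r' = h \<and> strictly_prefers (hospital_pref I h) r r'))"
    if "r \<in> residents I" for r h
    using that unfolding blocks_def card_residents_of_graph[OF fin]
    by (auto simp: unmatched_graph hospital_of_graph residents_of_graph)
  ultimately show ?thesis
    unfolding stable_matching_def matching_def
    by (auto simp: hospitals_of_graph card_residents_of_graph[OF fin] not_less)
qed

text \<open>An unmatched resident would block with any hospital that is not full. So all hospitals
  are full, and counting the pairs of \<open>M\<close> by hospital and by resident makes the total
  upper quota at most the number of residents, against the standing assumption.\<close>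

lemma stable_matching_matched:
  assumes I: "I \<in> HRT_MSLQ" and M: "stable_matching I M" and r: "r \<in> residents I"
  shows "\<not> unmatched M r"
proof
  assume un: "unmatched M r"
  have fin: "finite (residents I)" "finite (hospitals I)"
    by (simp_all add: residents_def hospitals_def)
  have sub: "M \<subseteq> residents I \<times> hospitals I"
    and le1: "\<And>r. r \<in> residents I \<Longrightarrow> card (hospitals_of M r) \<le> 1"
    using M by (simp_all add: stable_matching_def matching_def)
  have finH: "finite (hospitals_of M r)" for r
    using sub fin by (auto simp: hospitals_of_def intro: finite_subset)
  have finR: "finite (residents_of M h)" for h
    using sub fin by (auto simp: residents_of_def intro: finite_subset)
  have full: "upper I h \<le> card (residents_of M h)" if "h \<in> hospitals I" for h
    using M r un that by (auto simp: stable_matching_def blocks_def not_less)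
  have "(\<Sum>h\<in>hospitals I. upper I h) \<le> (\<Sum>h\<in>hospitals I. card (residents_of M h))"
    by (rule sum_mono) (rule full)
  also have "\<dots> = card (SIGMA h:hospitals I. residents_of M h)"
    using fin finR by (subst card_SigmaI) auto
  also have "(SIGMA h:hospitals I. residents_of M h) =
      (\<lambda>(r, h). (h, r)) ` (SIGMA r:residents I. hospitals_of M r)"
    using sub by (force simp: residents_of_def hospitals_of_def image_iff)
  also have "card \<dots> = card (SIGMA r:residents I. hospitals_of M r)"
    by (rule card_image) (auto simp: inj_on_def)
  also have "\<dots> = (\<Sum>r\<in>residents I. card (hospitals_of M r))"
    using fin finH by (subst card_SigmaI) auto
  also have "\<dots> \<le> card (residents I)"
    using sum_mono[of "residents I" "\<lambda>r. card (hospitals_of M r)" "\<lambda>_. 1"] le1 by simp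
  finally show False
    using I by (simp add: HRT_MSLQ_def)
qed

lemma stable_matching_imp_graph:
  assumes I: "I \<in> HRT_MSLQ" and M: "stable_matching I M"
  obtains f where "f \<in> residents I \<rightarrow> hospitals I" "M = graph (residents I) f"
proof -
  have sub: "M \<subseteq> residents I \<times> hospitals I"
    and le1: "\<And>r. r \<in> residents I \<Longrightarrow> card (hospitals_of M r) \<le> 1"
    using M by (simp_all add: stable_matching_def matching_def)
  have ex: "\<exists>h. hospitals_of M r = {h}" if "r \<in> residents I" for r
  proof -
    have "hospitals_of M r \<subseteq> hospitals I"
      using sub by (auto simp: hospitals_of_def)
    then have "finite (hospitals_of M r)"
      by (rule finite_subset) (simp add: hospitals_def)
    moreover have "hospitals_of M r \<noteq> {}"
      using stable_matching_matched[OF I M that] by (simp add: unmatched_def)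
    ultimately have "card (hospitals_of M r) = 1"
      using le1[OF that] by (metis card_gt_0_iff le_antisym One_nat_def Suc_leI)
    then show ?thesis
      by (rule card_1_singletonE) blast
  qed
  then obtain f where f: "\<And>r. r \<in> residents I \<Longrightarrow> hospitals_of M r = {f r}"
    by metis
  then have "(r, h) \<in> M \<longleftrightarrow> h = f r" if "r \<in> residents I" for r h
    using that by (auto simp: hospitals_of_def)
  then have "f \<in> residents I \<rightarrow> hospitals I" "M = graph (residents I) f"
    using sub by (auto simp: graph_def)
  then show ?thesis
    by (rule that)
qed

section \<open>The contest instances and their manipulation\<close>

text \<open>Small ranks are good and equal ranks are ties.\<close>

definition pref_by_rank :: "'a set \<Rightarrow> ('a \<Rightarrow> nat) \<Rightarrow> 'a rel" where
  "pref_by_rank S \<rho> = {(x, y). x \<in> S \<and> y \<in> S \<and> \<rho> x \<le> \<rho> y}"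

lemma pref_by_rank_complete: "pref_by_rank S \<rho> \<in> complete_lists S"
  by (auto simp: complete_lists_def pref_by_rank_def preorder_on_def refl_on_def total_on_def
      intro!: transI)

lemma strictly_prefers_pref_by_rank:
  "strictly_prefers (pref_by_rank S \<rho>) x y \<longleftrightarrow> x \<in> S \<and> y \<in> S \<and> \<rho> x < \<rho> y"
  by (auto simp: strictly_prefers_def pref_by_rank_def)

definition second_choice_pref :: "nat \<Rightarrow> nat rel" where
  "second_choice_pref k = pref_by_rank {1..3} (\<lambda>h. if h = 1 then 0 else if h = k then 1 else 2)"

text \<open>\<open>s r\<close> is the second choice of resident \<open>r \<in> {1, 2}\<close>. Only \<open>n = 2\<close> and \<open>n = 4\<close> are of interest.\<close>
definition contest :: "nat \<Rightarrow> (nat \<Rightarrow> nat) \<Rightarrow> nat \<Rightarrow> (nat \<Rightarrow> nat) \<Rightarrow> hrt" where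
  "contest n l u s =
    \<lparr>num_residents = n, num_hospitals = 3,
     resident_pref = (\<lambda>r\<in>{1..n}. if r \<le> 2 then second_choice_pref (s r)
                       else pref_by_rank {1..3} (\<lambda>h. if r = 3 then h else 3 - h)),
     hospital_pref = (\<lambda>h\<in>{1..3}. pref_by_rank {1..n} (\<lambda>r. if r \<le> 2 then 1 else 0)),
     lower = (\<lambda>h\<in>{1..3}. l h),
     upper = (\<lambda>h\<in>{1..3}. u)\<rparr>"

text \<open>Resident \<open>w \<in> {1, 2}\<close> wins the last place at hospital 1.\<close>
definition contest_outcome :: "(nat \<Rightarrow> nat) \<Rightarrow> nat \<Rightarrow> nat \<Rightarrow> nat" where
  "contest_outcome s w r =
     (if r = 4 then 3 else if r = 3 \<or> r = w then 1 else s r)"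

lemma residents_contest: "residents (contest n l u s) = {1..n}"
  and hospitals_contest: "hospitals (contest n l u s) = {1..3}"
  by (simp_all add: residents_def hospitals_def contest_def)

text \<open>Residents 3 and 4 have the lists 1, 2, 3 and 3, 2, 1: on these hospitals
  \<open>3 - h\<close> reverses the order.\<close>

lemma resident_pref_contest:
    "r \<in> {1..n} \<Longrightarrow> resident_pref (contest n l u s) r =
      (if r \<le> 2 then second_choice_pref (s r)
       else pref_by_rank {1..3} (\<lambda>h. if r = 3 then h else 3 - h))"
  and hospital_pref_contest:
    "h \<in> {1..3} \<Longrightarrow> hospital_pref (contest n l u s) h =
      pref_by_rank {1..n} (\<lambda>r. if r \<le> 2 then 1 else 0)"
  and lower_contest: "h \<in> {1..3} \<Longrightarrow> lower (contest n l u s) h = l h"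
  and upper_contest: "h \<in> {1..3} \<Longrightarrow> upper (contest n l u s) h = u"
  by (simp_all add: contest_def)

lemma contest_in_HRT_MSLQ:
  assumes "1 \<le> u" "u \<le> n" "n < 3 * u" "\<And>h. l h \<le> u"
  shows "contest n l u s \<in> HRT_MSLQ"
  using assms pref_by_rank_complete
  by (auto simp: HRT_MSLQ_def residents_contest hospitals_contest)
     (auto simp: contest_def second_choice_pref_def)

text \<open>The lie stays within the contest family, so one description of the stable matchings for
  all \<open>s\<close> covers the instances before and after it.\<close>

lemma misreport_contest:
  assumes "r \<in> {1, 2}" "r \<le> n"
  shows "misreport (contest n l u s) r (second_choice_pref k) = contest n l u (s(r := k))"
  using assms by (auto simp: misreport_def contest_def fun_eq_iff)

text \<open>Collects what the two models have in common. The loser is \<open>3 - w\<close>, and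
  \<open>c\<close> gives the score as a function of the loser's second choice.\<close>

lemma contest_manipulable:
  fixes c :: "nat \<Rightarrow> real"
  assumes n: "2 \<le> n"
    and stable: "\<And>s M. s \<in> UNIV \<rightarrow> {2, 3} \<Longrightarrow> stable_matching (contest n l u s) M \<longleftrightarrow>
      (\<exists>w\<in>{1, 2}. M = graph {1..n} (contest_outcome s w))"
    and score: "\<And>s w. s \<in> UNIV \<rightarrow> {2, 3} \<Longrightarrow> w \<in> {1, 2} \<Longrightarrow>
      score (contest n l u s) (graph {1..n} (contest_outcome s w)) = c (s (3 - w))"
    and c: "c 3 < c 2"
  shows "manipulable (contest n l u (\<lambda>_. 2))" (is "manipulable ?I")
  unfolding manipulable_def
proof (intro allI impI)
  fix M
  assume "optimal_solution ?I M"
  then obtain w where w: "w \<in> {1, 2}" and M: "M = graph {1..n} (contest_outcome (\<lambda>_. 2) w)"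
    using stable[of "\<lambda>_. 2"] by (auto simp: optimal_solution_def)
  define r where "r = 3 - w"
  let ?s = "(\<lambda>_. 2)(r := 3)"
  have s: "?s \<in> UNIV \<rightarrow> {2, 3}"
    by auto
  have r: "r \<in> {1, 2}" "r \<in> {1..n}" "r \<noteq> w" "w = 3 - r"
    using w n by (auto simp: r_def)
  have "\<not> weakly_prefers_outcome ?I r M M'"
    if opt: "optimal_solution (misreport ?I r (second_choice_pref 3)) M'" for M'
  proof -
    have mis: "misreport ?I r (second_choice_pref 3) = contest n l u ?s"
      using r by (intro misreport_contest) auto
    from opt have opt': "optimal_solution (contest n l u ?s) M'"
      unfolding mis .
    then obtain v where v: "v \<in> {1, 2}" and M': "M' = graph {1..n} (contest_outcome ?s v)"
      using stable[OF s] by (auto simp: optimal_solution_def)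
    have "v = r"
    proof (rule ccontr)
      assume "v \<noteq> r"
      then have "3 - v = r"
        using v r(1) by auto
      then have "score (contest n l u ?s) M' = c 3"
        using score[OF s v] M' by simp
      \<comment> \<open>If the liar wins, the loser is the other resident, whose second choice is
        still hospital 2.\<close>
      moreover have "score (contest n l u ?s) (graph {1..n} (contest_outcome ?s r)) = c 2"
        using score[OF s r(1)] r by auto
      moreover have "stable_matching (contest n l u ?s) (graph {1..n} (contest_outcome ?s r))"
        using stable[OF s] r(1) by blast
      ultimately show False
        using opt' c by (force simp: optimal_solution_def)
    qed
    \<comment> \<open>The liar moves from hospital 2 to hospital 1, the true first choice.\<close>
    then show ?thesis
      using r
      by (auto simp: M M' weakly_prefers_outcome_graph contest_outcome_def contest_def
          second_choice_pref_def pref_by_rank_def)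
  qed
  moreover have "r \<in> residents ?I"
    using r by (simp add: residents_contest)
  moreover have "second_choice_pref 3 \<in> complete_lists (hospitals ?I)"
    unfolding second_choice_pref_def hospitals_contest by (rule pref_by_rank_complete)
  ultimately show "\<exists>r\<in>residents ?I. \<exists>P\<in>complete_lists (hospitals ?I). \<forall>M'.
      optimal_solution (misreport ?I r P) M' \<longrightarrow> \<not> weakly_prefers_outcome ?I r M M'"
    by blast
qed

text \<open>Leaves only functions into the three hospitals to be examined. Agreement on
  \<open>{1..n}\<close> suffices because \<open>graph\<close> ignores all other values.\<close>

lemma stable_matching_contest:
  assumes I: "contest n l u s \<in> HRT_MSLQ"
    and s: "s \<in> UNIV \<rightarrow> {2, 3}"
    and graph: "\<And>f. f \<in> {1..n} \<rightarrow> {1..3} \<Longrightarrow> stable_matching (contest n l u s) (graph {1..n} f) \<longleftrightarrow>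
      (\<exists>w\<in>{1, 2}. \<forall>r\<in>{1..n}. f r = contest_outcome s w r)"
  shows "stable_matching (contest n l u s) M \<longleftrightarrow>
      (\<exists>w\<in>{1, 2}. M = graph {1..n} (contest_outcome s w))"
proof
  assume M: "stable_matching (contest n l u s) M"
  with I obtain f where f: "f \<in> {1..n} \<rightarrow> {1..3}" "M = graph {1..n} f"
    by (auto elim: stable_matching_imp_graph simp: residents_contest hospitals_contest)
  with M obtain w where "w \<in> {1, 2}" "\<forall>r\<in>{1..n}. f r = contest_outcome s w r"
    using graph by blast
  moreover from this(2) have "M = graph {1..n} (contest_outcome s w)"
    unfolding f(2) graph_def by (intro image_cong) auto
  ultimately show "\<exists>w\<in>{1, 2}. M = graph {1..n} (contest_outcome s w)"
    by blast
next
  assume "\<exists>w\<in>{1, 2}. M = graph {1..n} (contest_outcome s w)"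
  moreover have "contest_outcome s w r \<in> {1..3}" for w r
    using funcset_mem[OF s, of r] by (auto simp: contest_outcome_def)
  then have "contest_outcome s w \<in> {1..n} \<rightarrow> {1..3}" for w
    by auto
  ultimately show "stable_matching (contest n l u s) M"
    using graph by blast
qed

section \<open>Evaluation of the marriage and the uniform contest\<close>

lemma atLeastAtMost_1_2: "{1..2} = {1, 2::nat}"
  and atLeastAtMost_1_3: "{1..3} = {1, 2, 3::nat}"
  and atLeastAtMost_1_4: "{1..4} = {1, 2, 3, 4::nat}"
  by auto

lemmas contest_eval = residents_contest hospitals_contest atLeastAtMost_1_2 atLeastAtMost_1_3
  atLeastAtMost_1_4 resident_pref_contest
  hospital_pref_contest lower_contest upper_contest second_choice_pref_def strictly_prefers_pref_by_rank
  contest_outcome_def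

abbreviation marriage_contest :: "(nat \<Rightarrow> nat) \<Rightarrow> hrt" where
  "marriage_contest \<equiv> contest 2 (\<lambda>h. if h = 2 then 1 else 0) 1"

abbreviation uniform_contest :: "(nat \<Rightarrow> nat) \<Rightarrow> hrt" where
  "uniform_contest \<equiv> contest 4 (\<lambda>_. 1) 2"

text \<open>All hospitals are indifferent between the two residents, so the only constraints are
  that hospital 1 is taken and that the loser gets the second choice, which is free.\<close>

lemma marriage_contest_manipulable: "manipulable (marriage_contest (\<lambda>_. 2))"
proof (rule contest_manipulable)
  fix s :: "nat \<Rightarrow> nat" and M
  assume s: "s \<in> UNIV \<rightarrow> {2, 3}"
  then have s12: "s 1 = 2 \<or> s 1 = 3" "s 2 = 2 \<or> s 2 = 3"
    by auto
  show "stable_matching (marriage_contest s) M \<longleftrightarrow>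
      (\<exists>w\<in>{1, 2}. M = graph {1..2} (contest_outcome s w))"
  proof (rule stable_matching_contest[OF contest_in_HRT_MSLQ s])
    fix f :: "nat \<Rightarrow> nat"
    assume f: "f \<in> {1..2} \<rightarrow> {1..3}"
    then have "f 1 \<in> {1..3}" "f 2 \<in> {1..3}"
      by auto
    then have f12: "f 1 = 1 \<or> f 1 = 2 \<or> f 1 = 3" "f 2 = 1 \<or> f 2 = 2 \<or> f 2 = 3"
      unfolding atLeastAtMost_1_3 by blast+
    have "f \<in> residents (marriage_contest s) \<rightarrow> hospitals (marriage_contest s)"
      using f by (simp add: residents_contest hospitals_contest)
    from stable_matching_graph_iff[OF this] show
      "stable_matching (marriage_contest s) (graph {1..2} f) \<longleftrightarrow>
       (\<exists>w\<in>{1, 2}. \<forall>r\<in>{1..2}. f r = contest_outcome s w r)"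
      unfolding residents_contest
      \<comment> \<open>There are 36 cases: two second choices and three hospitals for each of the
        two residents.\<close>
      using s12 f12 by (elim disjE; simp add: contest_eval del: One_nat_def)
  qed auto
next
  fix s :: "nat \<Rightarrow> nat" and w :: nat
  assume "s \<in> UNIV \<rightarrow> {2, 3}" "w \<in> {1, 2}"
  then have "s (3 - w) = 2 \<or> s (3 - w) = 3" "w = 1 \<or> w = 2"
    by auto
  \<comment> \<open>The right-hand side determines \<open>c\<close>: hospitals 1 and 3 always score
    1, and hospital 2 does so exactly if the loser is there.\<close>
  then show "score (marriage_contest s) (graph {1..2} (contest_outcome s w)) =
      (if s (3 - w) = 2 then 3 else 2)"
    by (elim disjE; simp add: score_def hospital_score_def card_residents_of_graph contest_eval
        One_nat_def[symmetric] del: One_nat_def)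
qed auto

text \<open>Residents 3 and 4 beat the contestants everywhere and so get their first choices,
  hospitals 1 and 3, in every stable matching. This leaves one place at each and already meets both
  lower quotas, so again only hospital 2 can lose score.\<close>

lemma uniform_contest_manipulable: "manipulable (uniform_contest (\<lambda>_. 2))"
proof (rule contest_manipulable)
  fix s :: "nat \<Rightarrow> nat" and M
  assume s: "s \<in> UNIV \<rightarrow> {2, 3}"
  then have s12: "s 1 = 2 \<or> s 1 = 3" "s 2 = 2 \<or> s 2 = 3"
    by auto
  show "stable_matching (uniform_contest s) M \<longleftrightarrow>
      (\<exists>w\<in>{1, 2}. M = graph {1..4} (contest_outcome s w))"
  proof (rule stable_matching_contest[OF contest_in_HRT_MSLQ s])
    fix f :: "nat \<Rightarrow> nat"
    assume f: "f \<in> {1..4} \<rightarrow> {1..3}"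
    then have "f 1 \<in> {1..3}" "f 2 \<in> {1..3}" "f 3 \<in> {1..3}" "f 4 \<in> {1..3}"
      by auto
    then have f1234: "f 1 = 1 \<or> f 1 = 2 \<or> f 1 = 3" "f 2 = 1 \<or> f 2 = 2 \<or> f 2 = 3"
      "f 3 = 1 \<or> f 3 = 2 \<or> f 3 = 3" "f 4 = 1 \<or> f 4 = 2 \<or> f 4 = 3"
      unfolding atLeastAtMost_1_3 by blast+
    have "f \<in> residents (uniform_contest s) \<rightarrow> hospitals (uniform_contest s)"
      using f by (simp add: residents_contest hospitals_contest)
    note iff = stable_matching_graph_iff[OF this, unfolded residents_contest]
    show "stable_matching (uniform_contest s) (graph {1..4} f) \<longleftrightarrow>
       (\<exists>w\<in>{1, 2}. \<forall>r\<in>{1..4}. f r = contest_outcome s w r)"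
      apply (subst iff)
      \<comment> \<open>Evaluating the instance before the case split keeps each of the 324 cases cheap.\<close>
      apply (simp add: contest_eval del: One_nat_def split del: if_split cong: if_cong)
      using s12 f1234 by (elim disjE; simp del: One_nat_def)
  qed auto
next
  fix s :: "nat \<Rightarrow> nat" and w :: nat
  assume "s \<in> UNIV \<rightarrow> {2, 3}" "w \<in> {1, 2}"
  then have "s (3 - w) = 2 \<or> s (3 - w) = 3" "w = 1 \<or> w = 2"
    by auto
  then show "score (uniform_contest s) (graph {1..4} (contest_outcome s w)) =
      (if s (3 - w) = 2 then 3 else 2)"
    by (elim disjE; simp add: score_def hospital_score_def card_residents_of_graph contest_eval
        One_nat_def[symmetric] del: One_nat_def)
qed auto

lemma marriage_contest_in_marriage_HRT_MSLQ: "marriage_contest s \<in> marriage_HRT_MSLQ"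
  using contest_in_HRT_MSLQ[of 1 2 "\<lambda>h. if h = 2 then 1 else 0" s]
  by (simp add: marriage_HRT_MSLQ_def hospitals_contest) (simp add: contest_def)

lemma uniform_contest_in_uniform_HRT_MSLQ: "uniform_contest s \<in> uniform_HRT_MSLQ"
  using contest_in_HRT_MSLQ[of 2 4 "\<lambda>_. 1" s]
  by (simp add: uniform_HRT_MSLQ_def hospitals_contest) (simp add: contest_def)

theorem proposition3:
  shows "(\<nexists>A. strategy_proof_for_residents HRT_MSLQ A \<and>
               returns_optimal_solutions HRT_MSLQ A) \<and>
         (\<nexists>A. strategy_proof_for_residents uniform_HRT_MSLQ A \<and>
               returns_optimal_solutions uniform_HRT_MSLQ A) \<and>
         (\<nexists>A. strategy_proof_for_residents marriage_HRT_MSLQ A \<and>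
               returns_optimal_solutions marriage_HRT_MSLQ A)"
proof (intro conjI)
  \<comment> \<open>For the full family either manipulable instance would do.\<close>
  have "marriage_contest (\<lambda>_. 2) \<in> HRT_MSLQ"
    using marriage_contest_in_marriage_HRT_MSLQ by (simp add: marriage_HRT_MSLQ_def)
  then show "\<nexists>A. strategy_proof_for_residents HRT_MSLQ A \<and> returns_optimal_solutions HRT_MSLQ A"
    by (intro manipulable_imp_no_strategy_proof[OF marriage_contest_manipulable]
        misreport_in_HRT_MSLQ)
  show "\<nexists>A. strategy_proof_for_residents uniform_HRT_MSLQ A \<and>
      returns_optimal_solutions uniform_HRT_MSLQ A"
    by (intro manipulable_imp_no_strategy_proof[OF uniform_contest_manipulable]
        misreport_in_uniform_HRT_MSLQ uniform_contest_in_uniform_HRT_MSLQ)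
  show "\<nexists>A. strategy_proof_for_residents marriage_HRT_MSLQ A \<and>
      returns_optimal_solutions marriage_HRT_MSLQ A"
    by (intro manipulable_imp_no_strategy_proof[OF marriage_contest_manipulable]
        misreport_in_marriage_HRT_MSLQ marriage_contest_in_marriage_HRT_MSLQ)
qed

end
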